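(* Let $A\subseteq\mathbb{R}^2$ be measurable and let $n\geq1$ be an integer. For each $\eta\in\{0,1\}^n$ let $f_\eta\in\{\mathbb{1}_A,\mathbb{1}_{\mathbb{R}^2}\}$, and assume that at least one $f_\eta$ equals $\mathbb{1}_A$. Then there exist constants $c_n,C_n\in(0,\infty)$ depending only on $n$ such that $$c_n\,\overline{\delta}(A)^{2^n}\ \leq\ \overline{\delta}\big((f_\eta)_{\eta\in\{0,1\}^n}\big)\ \leq\ C_n\,\overline{\delta}(A)^{\frac{n+1}{2^n}} .$$
   Context: $\mathbb{1}_S$ denotes the indicator function of $S$ and $|\cdot|$ of a set is Lebesgue measure. The upper Banach density of a measurable $A\subseteq\mathbb{R}^2$ is $$\overline{\delta}(A):=\limsup_{R\to\infty}\sup_{z\in\mathbb{R}^2}\frac{|A\cap(z+[0,R]^2)|}{R^2}.$$ For $2^n$ locally integrable functions $(f_\eta)_{\eta\in\{0,1\}^n}$ on $\mathbb{R}^2$ define $$\overline{\delta}\big((f_\eta)_{\eta\in\{0,1\}^n}\big):=\sup_{M\geq1}\ \limsup_{R\to+\infty}\ \sup_{z\in\mathbb{R}^2}\ \inf_{M\leq r\leq2^{-n}R}\ \frac{1}{(2r)^{2n}R^2}\int_{z+[0,R]^2}\int_{([-r,r]^2)^n}\ \prod_{\eta\in\{0,1\}^n}f_\eta(x+\eta_1v_1+\dots+\eta_nv_n)\ dv_1\cdots dv_n\,dx .$$ *)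

theory Defs
  imports "HOL-Analysis.Analysis"
begin

text \<open>The plane is \<^typ>\<open>real^2\<close> and \<open>vec R\<close> is the vector \<open>(R, R)\<close>, so that
  \<open>cbox z (z + vec R)\<close> is \<open>z + [0,R]\<^sup>2\<close>. The upper Banach density always lies in \<open>[0,1]\<close>;
  the extended reals are only used to form the suprema and the limit superior.\<close>

definition upper_Banach_density :: "(real^2) set \<Rightarrow> real" where
  "upper_Banach_density A =
     real_of_ereal (Limsup at_top (\<lambda>R::real.
       SUP z. ereal (measure lebesgue (A \<inter> cbox z (z + vec R)) / R^2)))"

text \<open>The index set \<open>{0,1}\<^sup>n\<close>, with coordinates numbered \<open>0, \<dots>, n - 1\<close>.\<close>

definition bin_cube :: "nat \<Rightarrow> (nat \<Rightarrow> nat) set" where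
  "bin_cube n = ({..<n} \<rightarrow>\<^sub>E {0,1})"

text \<open>The inner measure is \<open>2n\<close>-dimensional Lebesgue measure on \<open>(\<real>\<^sup>2)\<^sup>n\<close>. It is the completion
  of the product of the Borel measures: for a Lebesgue measurable \<open>f\<close> that is not Borel, the map
  \<open>v \<mapsto> f (x + v\<^sub>1 + v\<^sub>2)\<close> need not be measurable for the product of the Lebesgue
  sigma-algebras.\<close>

definition box_average ::
    "nat \<Rightarrow> ((nat \<Rightarrow> nat) \<Rightarrow> real^2 \<Rightarrow> real) \<Rightarrow> real^2 \<Rightarrow> real \<Rightarrow> real \<Rightarrow> real" where
  "box_average n f z R r =
     1 / ((2 * r) ^ (2 * n) * R^2) *
     (LINT x:cbox z (z + vec R)|lebesgue.
       (LINT v:(\<Pi>\<^sub>E i\<in>{..<n}. cbox (vec (- r)) (vec r))|completion (\<Pi>\<^sub>M i\<in>{..<n}. lborel).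
         (\<Prod>\<eta>\<in>bin_cube n. f \<eta> (x + (\<Sum>i<n. real (\<eta> i) *\<^sub>R v i)))))"

text \<open>For \<open>R < 2\<^sup>n M\<close> the infimum is over the empty set; this does not affect the limit superior.\<close>

definition family_density :: "nat \<Rightarrow> ((nat \<Rightarrow> nat) \<Rightarrow> real^2 \<Rightarrow> real) \<Rightarrow> ereal" where
  "family_density n f =
     (SUP M\<in>{1::real..}. Limsup at_top (\<lambda>R::real.
       SUP z. INF r\<in>{M..R / 2 ^ n}. ereal (box_average n f z R r)))"

end

theory Submission
  imports Defs
begin

text \<open>
  Upper bound: discarding all factors but one \<open>f\<^sub>\<theta> = 1\<^sub>A\<close> and integrating over \<open>x\<close> first bounds every
  box average by the largest density of \<open>A\<close> in a square of side \<open>R\<close>, so the family density is at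
  most \<open>\<delta>(A) \<le> \<delta>(A)\<^bsup>(n+1)/2^n\<^esup>\<close>, as \<open>\<delta>(A) \<le> 1\<close> and \<open>n + 1 \<le> 2\<^sup>n\<close>.

  Lower bound: replace every \<open>f\<^sub>\<eta>\<close> by the indicator of \<open>B\<close>, the part of \<open>A\<close> in the square of side
  \<open>R\<close>. Integrating out the last shift \<open>w\<close> turns the count of \<open>(n+1)\<close>-dimensional cubes in \<open>B\<close> into
  the integral over \<open>w\<close> of the count of \<open>n\<close>-dimensional cubes in \<open>B \<inter> (B - w)\<close>. Cauchy-Schwarz
  for \<open>c \<mapsto> |B \<inter> (c + [0,r]\<^sup>2)|\<close> shows that \<open>|B \<inter> (B - w)|\<close> is on average at least
  \<open>|B|\<^sup>2 / (16 R\<^sup>2)\<close> over \<open>w \<in> [-r,r]\<^sup>2\<close>, and the power mean inequality closes the induction, uniformly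
  in \<open>r \<le> R\<close>.
\<close>

section \<open>Reduction to Borel functions\<close>

text \<open>Preimages under \<open>f\<close> and \<open>g\<close> differ only inside a null set, and
  the completion contains every subset of a null set.\<close>

lemma measurable_completion_cong_AE:
  assumes g: "g \<in> borel_measurable M" and ae: "AE x in M. f x = g x"
  shows "f \<in> borel_measurable (completion M)"
proof (rule measurableI)
  fix S :: "'b set" assume S: "S \<in> sets borel"
  have *: "g -` S \<inter> space M \<in> sets (completion M)"
    using measurable_sets[OF g S] by simp
  have "AE x in completion M. x \<in> g -` S \<inter> space M \<longleftrightarrow> x \<in> f -` S \<inter> space M"
    by (rule AE_completion) (use ae in auto)
  from completion.in_sets_AE[OF this *]
  show "f -` S \<inter> space (completion M) \<in> sets (completion M)"
    by simp
qed simp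

text \<open>Moves the completed integrals of \<open>box_average\<close> to the uncompleted measures,
  where product measurability and Tonelli are available.\<close>

lemma integral_completion_cong_AE:
  fixes f g :: "'a \<Rightarrow> 'b::{banach, second_countable_topology}"
  assumes "g \<in> borel_measurable M" and "AE x in M. f x = g x"
  shows "integral\<^sup>L (completion M) f = integral\<^sup>L M g"
proof -
  have "integral\<^sup>L (completion M) f = integral\<^sup>L (completion M) g"
    using assms
    by (intro integral_cong_AE measurable_completion_cong_AE[of g] AE_completion)
      (auto intro: measurable_completion)
  then show ?thesis
    using assms(1) by (simp add: integral_completion)
qed

interpretation lborel_PiM: product_sigma_finite "\<lambda>_::nat. lborel :: 'a::euclidean_space measure" ..

section \<open>The binary cube and translates of null sets\<close>

lemma finite_bin_cube [simp]: "finite (bin_cube n)"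
  by (simp add: bin_cube_def finite_PiE)

lemma bin_cube_Suc: "bin_cube (Suc n) = (\<lambda>\<eta>. \<eta>(n := 0)) ` bin_cube n \<union> (\<lambda>\<eta>. \<eta>(n := 1)) ` bin_cube n"
proof -
  have "bin_cube (Suc n) = (\<lambda>(y, \<eta>). \<eta>(n := y)) ` ({0, 1} \<times> bin_cube n)"
    unfolding bin_cube_def lessThan_Suc PiE_insert_eq by simp
  also have "{0, 1} \<times> bin_cube n = Pair 0 ` bin_cube n \<union> Pair 1 ` bin_cube n"
    by auto
  finally show ?thesis
    by (simp add: image_Un image_image fun_upd_def)
qed

text \<open>Pairs the two vertices that differ only in the last coordinate, so that
  \<open>prod_vertex_Suc\<close> can merge their factors into one indicator.\<close>

lemma prod_bin_cube_Suc:
  "(\<Prod>\<eta>\<in>bin_cube (Suc n). F \<eta>) = (\<Prod>\<eta>\<in>bin_cube n. F (\<eta>(n := 0)) * F (\<eta>(n := Suc 0)))"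
proof -
  have inj: "inj_on (\<lambda>\<eta>. \<eta>(n := k)) (bin_cube n)" for k
  proof (rule inj_onI)
    fix \<eta> \<theta> assume *: "\<eta> \<in> bin_cube n" "\<theta> \<in> bin_cube n" "\<eta>(n := k) = \<theta>(n := k)"
    then have "\<eta> i = \<theta> i" for i
      by (cases "i = n") (auto simp: bin_cube_def PiE_def extensional_def dest: fun_cong[of _ _ i])
    then show "\<eta> = \<theta>" by blast
  qed
  have "(\<lambda>\<eta>. \<eta>(n := 0)) ` bin_cube n \<inter> (\<lambda>\<eta>. \<eta>(n := 1)) ` bin_cube n = {}"
    by (auto dest: fun_cong[of _ _ n])
  then show ?thesis
    by (simp add: bin_cube_Suc prod.union_disjoint prod.reindex[OF inj] prod.distrib)
qed

lemma nn_integral_lborel_translate: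
  fixes c :: "'a::euclidean_space"
  assumes [measurable]: "f \<in> borel_measurable borel"
  shows "(\<integral>\<^sup>+y. f (c + y) \<partial>lborel) = (\<integral>\<^sup>+y. f y \<partial>lborel)"
proof -
  have "(\<integral>\<^sup>+y. f y \<partial>lborel) = (\<integral>\<^sup>+y. f y \<partial>distr lborel borel ((+) c))"
    by (simp only: lborel_distr_plus)
  then show ?thesis
    by (simp add: nn_integral_distr)
qed

text \<open>With all other shifts fixed, the vertex is a translate of the shift \<open>v j\<close>,
  because its coefficient \<open>\<eta> j\<close> is 1. Integrating over \<open>v j\<close> first
  therefore gives the measure of a translate of \<open>N\<close>, which is 0.\<close>

lemma AE_vertex:
  fixes N :: "'a::euclidean_space set" and x :: 'a
  assumes N: "N \<in> null_sets lborel" and J: "finite J" "(j::nat) \<notin> J" and \<eta>: "\<eta> j = (1::nat)"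
  shows "AE v in (\<Pi>\<^sub>M i\<in>insert j J. lborel). x + (\<Sum>i\<in>insert j J. real (\<eta> i) *\<^sub>R v i) \<notin> N"
proof -
  have [measurable]: "N \<in> sets borel" using N by auto
  have inner: "(\<integral>\<^sup>+y. indicator N (c + y) \<partial>lborel) = 0" for c :: 'a
  proof -
    have "(\<integral>\<^sup>+y. indicator N (c + y) \<partial>lborel) = (\<integral>\<^sup>+y. indicator N y \<partial>lborel)"
      by (rule nn_integral_lborel_translate) auto
    then show ?thesis
      using N by (simp add: null_setsD1)
  qed
  have split: "x + (\<Sum>i\<in>insert j J. real (\<eta> i) *\<^sub>R (v(j := y)) i) = x + (\<Sum>i\<in>J. real (\<eta> i) *\<^sub>R v i) + y" for v y
  proof -
    have "(\<Sum>i\<in>J. real (\<eta> i) *\<^sub>R (v(j := y)) i) = (\<Sum>i\<in>J. real (\<eta> i) *\<^sub>R v i)"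
      using J by (intro sum.cong) auto
    then show ?thesis
      using J \<eta> by (simp add: ac_simps)
  qed
  have "(\<integral>\<^sup>+v. indicator N (x + (\<Sum>i\<in>insert j J. real (\<eta> i) *\<^sub>R v i)) \<partial>(\<Pi>\<^sub>M i\<in>insert j J. lborel)) = 0"
    by (subst lborel_PiM.product_nn_integral_insert[OF J], measurable) (simp only: split inner, simp)
  then show ?thesis
    by (subst (asm) nn_integral_0_iff_AE) (measurable, auto simp: indicator_def split: if_splits)
qed

section \<open>Vertices, shifts and the box average as a nonnegative integral\<close>

abbreviation vertex :: "nat \<Rightarrow> (nat \<Rightarrow> nat) \<Rightarrow> real^2 \<Rightarrow> (nat \<Rightarrow> real^2) \<Rightarrow> real^2" where
  "vertex n \<eta> x v \<equiv> x + (\<Sum>i<n. real (\<eta> i) *\<^sub>R v i)"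

abbreviation shifts :: "nat \<Rightarrow> real \<Rightarrow> (nat \<Rightarrow> real^2) set" where
  "shifts n r \<equiv> \<Pi>\<^sub>E i\<in>{..<n}. cbox (vec (- r)) (vec r)"

abbreviation shift_space :: "nat \<Rightarrow> (nat \<Rightarrow> real^2) measure" where
  "shift_space n \<equiv> \<Pi>\<^sub>M i\<in>{..<n}. lborel"

lemma emeasure_square:
  fixes z :: "real^2"
  assumes "0 \<le> s"
  shows "emeasure lborel (cbox z (z + vec s)) = ennreal (s\<^sup>2)"
proof -
  have "cbox z (z + vec s) \<noteq> {}"
    using assms by (simp add: interval_ne_empty_cart)
  then have "measure lborel (cbox z (z + vec s)) = s\<^sup>2"
    using content_cbox_cart[of z "z + vec s"] by (simp add: UNIV_2 power2_eq_square)
  then show ?thesis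
    by (metis emeasure_eq_ennreal_measure emeasure_lborel_cbox_finite infinity_ennreal_def less_irrefl)
qed

lemma emeasure_centered_square:
  assumes "0 \<le> r"
  shows "emeasure lborel (cbox (vec (- r)) (vec r) :: (real^2) set) = ennreal ((2 * r)\<^sup>2)"
proof -
  have "(vec r :: real^2) = vec (- r) + vec (2 * r)"
    by (simp add: vec_eq_iff)
  then show ?thesis
    using emeasure_square[of "2 * r" "vec (- r)"] assms by simp
qed

lemma sets_shifts [measurable]: "shifts n r \<in> sets (shift_space n)"
  by (rule sets_PiM_I_finite) auto

lemma emeasure_shifts:
  assumes "0 \<le> r"
  shows "emeasure (shift_space n) (shifts n r) = ennreal ((2 * r) ^ (2 * n))"
proof -
  have "emeasure (shift_space n) (shifts n r) =
      (\<Prod>i<n. emeasure lborel (cbox (vec (- r)) (vec r) :: (real^2) set))"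
    by (rule lborel_PiM.emeasure_PiM) auto
  then show ?thesis
    using assms by (simp only: emeasure_centered_square prod_constant card_lessThan ennreal_power
        zero_le_power2 power_mult)
qed

lemma sigma_finite_shift_space: "sigma_finite_measure (shift_space n)"
  by (rule lborel_PiM.sigma_finite) simp

text \<open>A nonzero \<open>\<eta>\<close> has a coordinate equal to 1, so \<open>AE_vertex\<close>
  applies. The zero vertex is \<open>x\<close> itself, which does not move with \<open>v\<close>;
  this is what \<open>x \<notin> N\<close> is for.\<close>

lemma AE_vertices:
  assumes N: "N \<in> null_sets lborel" and x: "x \<notin> N"
  shows "AE v in shift_space n. \<forall>\<eta>\<in>bin_cube n. vertex n \<eta> x v \<notin> N"
proof (rule AE_finite_allI)
  fix \<eta> assume \<eta>: "\<eta> \<in> bin_cube n"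
  show "AE v in shift_space n. vertex n \<eta> x v \<notin> N"
  proof (cases "\<exists>j<n. \<eta> j = 1")
    case True
    then obtain j where j: "j < n" "\<eta> j = 1" by blast
    then have ins: "insert j ({..<n} - {j}) = {..<n}" by auto
    show ?thesis
      using AE_vertex[OF N, of "{..<n} - {j}" j \<eta> x] j unfolding ins by simp
  next
    case False
    with \<eta> have "\<eta> i = 0" if "i < n" for i
      using that by (auto simp: bin_cube_def PiE_def Pi_def)
    then show ?thesis using x by simp
  qed
qed simp

text \<open>Bridge from Bochner integrals to nonnegative ones, where Tonelli and monotonicity need
  no integrability. Boundedness on a set of finite measure supplies the integrability once and for
  all.\<close>

lemma ennreal_set_integral:
  fixes f :: "'a \<Rightarrow> real"
  assumes [measurable]: "S \<in> sets M" "f \<in> borel_measurable M"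
    and "emeasure M S < \<infinity>" and bounds: "\<And>x. 0 \<le> f x" "\<And>x. f x \<le> K"
  shows "ennreal (LINT x:S|M. f x) = (\<integral>\<^sup>+x\<in>S. ennreal (f x) \<partial>M)"
proof -
  have "integrable M (\<lambda>x. indicat_real S x * f x)"
  proof (rule Bochner_Integration.integrable_bound)
    show "integrable M (\<lambda>x. K * indicat_real S x)"
      using assms by (intro integrable_mult_right integrable_real_indicator) auto
    show "AE x in M. norm (indicat_real S x * f x) \<le> norm (K * indicat_real S x)"
      using bounds by (intro AE_I2) (auto simp: indicator_def intro: order_trans[OF _ abs_ge_self])
  qed measurable
  then have "(\<integral>\<^sup>+x. ennreal (indicat_real S x * f x) \<partial>M) = ennreal (LINT x:S|M. f x)"
    unfolding set_lebesgue_integral_def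
    using bounds by (subst nn_integral_eq_integral) (auto simp: indicator_def)
  then show ?thesis
    using bounds by (simp add: ennreal_mult mult.commute ennreal_indicator flip: ennreal_indicator)
qed

text \<open>For \<open>x \<in> N\<close> the inner integrand may disagree with its Borel version on a set of positive measure,
  because of the vertex \<open>\<eta> = 0\<close>; only almost every \<open>x\<close> matters.\<close>

lemma box_average_cong_AE:
  assumes N: "N \<in> null_sets lborel"
    and g: "\<And>\<eta>. \<eta> \<in> bin_cube n \<Longrightarrow> g \<eta> \<in> borel_measurable borel"
    and eq: "\<And>\<eta> x. \<eta> \<in> bin_cube n \<Longrightarrow> x \<notin> N \<Longrightarrow> f \<eta> x = g \<eta> x"
  shows "box_average n f z R r = 1 / ((2 * r) ^ (2 * n) * R^2) *
    (LINT x:cbox z (z + vec R)|lborel.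
       (LINT v:shifts n r|shift_space n. (\<Prod>\<eta>\<in>bin_cube n. g \<eta> (vertex n \<eta> x v))))"
proof -
  interpret V: sigma_finite_measure "shift_space n" by (rule sigma_finite_shift_space)
  define G where "G x v = (\<Prod>\<eta>\<in>bin_cube n. g \<eta> (vertex n \<eta> x v))" for x v
  have [measurable]: "(\<lambda>p. g \<eta> (vertex n \<eta> (fst p) (snd p))) \<in> borel_measurable (lborel \<Otimes>\<^sub>M shift_space n)"
    if "\<eta> \<in> bin_cube n" for \<eta>
    by (rule measurable_compose[OF _ g[OF that]]) measurable
  have G: "(\<lambda>p. G (fst p) (snd p)) \<in> borel_measurable (lborel \<Otimes>\<^sub>M shift_space n)"
    unfolding G_def by (rule borel_measurable_prod) simp
  have [measurable]: "case_prod G \<in> borel_measurable (lborel \<Otimes>\<^sub>M shift_space n)"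
    using G by (simp add: case_prod_unfold)
  have [measurable]: "G x \<in> borel_measurable (shift_space n)" for x
    using measurable_compose[OF measurable_Pair1' G, of x] by simp
  have "(LINT v:shifts n r|completion (shift_space n). (\<Prod>\<eta>\<in>bin_cube n. f \<eta> (vertex n \<eta> x v))) =
      (LINT v:shifts n r|shift_space n. G x v)" if x: "x \<notin> N" for x
    unfolding set_lebesgue_integral_def
  proof (rule integral_completion_cong_AE)
    show "AE v in shift_space n. indicat_real (shifts n r) v *\<^sub>R (\<Prod>\<eta>\<in>bin_cube n. f \<eta> (vertex n \<eta> x v)) =
        indicat_real (shifts n r) v *\<^sub>R G x v"
      using AE_vertices[OF N x, of n] by eventually_elim (simp add: eq G_def cong: prod.cong)
  qed measurable
  then show ?thesis
    unfolding G_def[symmetric] box_average_def set_lebesgue_integral_def[of _ "cbox z (z + vec R)"]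
  proof (intro arg_cong[where f = "(*) _"] integral_completion_cong_AE, goal_cases)
    case 1
    show ?case
      unfolding set_lebesgue_integral_def by measurable
  next
    case 2
    show ?case
      using AE_not_in[OF N] by eventually_elim (use 2 in simp)
  qed
qed

text \<open>The denominators are multiplied out, so that both density bounds become inequalities
  between iterated nonnegative integrals of Borel functions.\<close>

lemma box_average_nn:
  assumes N: "N \<in> null_sets lborel"
    and g: "\<And>\<eta>. \<eta> \<in> bin_cube n \<Longrightarrow> g \<eta> \<in> borel_measurable borel"
    and bounds: "\<And>\<eta> x. 0 \<le> g \<eta> x" "\<And>\<eta> x. g \<eta> x \<le> 1"
    and eq: "\<And>\<eta> x. \<eta> \<in> bin_cube n \<Longrightarrow> x \<notin> N \<Longrightarrow> f \<eta> x = g \<eta> x"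
    and r: "0 < r" and R: "0 < R"
  shows "0 \<le> box_average n f z R r" (is ?nonneg)
    and "ennreal ((2 * r) ^ (2 * n) * R^2 * box_average n f z R r) =
      (\<integral>\<^sup>+x\<in>cbox z (z + vec R). (\<integral>\<^sup>+v\<in>shifts n r.
        ennreal (\<Prod>\<eta>\<in>bin_cube n. g \<eta> (vertex n \<eta> x v)) \<partial>shift_space n) \<partial>lborel)" (is ?eq)
proof -
  interpret V: sigma_finite_measure "shift_space n" by (rule sigma_finite_shift_space)
  define G where "G x v = (\<Prod>\<eta>\<in>bin_cube n. g \<eta> (vertex n \<eta> x v))" for x v
  have [measurable]: "(\<lambda>p. g \<eta> (vertex n \<eta> (fst p) (snd p))) \<in> borel_measurable (lborel \<Otimes>\<^sub>M shift_space n)"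
    if "\<eta> \<in> bin_cube n" for \<eta>
    by (rule measurable_compose[OF _ g[OF that]]) measurable
  have G: "(\<lambda>p. G (fst p) (snd p)) \<in> borel_measurable (lborel \<Otimes>\<^sub>M shift_space n)"
    unfolding G_def by (rule borel_measurable_prod) simp
  have [measurable]: "case_prod G \<in> borel_measurable (lborel \<Otimes>\<^sub>M shift_space n)"
    using G by (simp add: case_prod_unfold)
  have [measurable]: "G x \<in> borel_measurable (shift_space n)" for x
    using measurable_compose[OF measurable_Pair1' G, of x] by simp
  have G01: "0 \<le> G x v" "G x v \<le> 1" for x v
    using bounds by (auto simp: G_def intro: prod_nonneg prod_le_1)
  define I where "I x = (LINT v:shifts n r|shift_space n. G x v)" for x
  have [measurable]: "I \<in> borel_measurable lborel"
    unfolding I_def set_lebesgue_integral_def by measurable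
  have I_nn: "ennreal (I x) = (\<integral>\<^sup>+v\<in>shifts n r. ennreal (G x v) \<partial>shift_space n)" for x
    unfolding I_def using emeasure_shifts[of r n] r G01 by (intro ennreal_set_integral) auto
  have I0: "0 \<le> I x" for x
    unfolding I_def set_lebesgue_integral_def using G01 by (intro integral_nonneg_AE) auto
  \<comment> \<open>The volume of the shift box bounds the inner integral, which makes the outer one
    integrable over the square.\<close>
  have I1: "I x \<le> (2 * r) ^ (2 * n)" for x
  proof -
    have "ennreal (I x) \<le> (\<integral>\<^sup>+v. indicator (shifts n r) v \<partial>shift_space n)"
      unfolding I_nn using G01 by (intro nn_integral_mono) (auto simp: indicator_def)
    then show ?thesis
      using r by (simp add: emeasure_shifts)
  qed
  have avg: "(2 * r) ^ (2 * n) * R^2 * box_average n f z R r = (LINT x:cbox z (z + vec R)|lborel. I x)"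
    using box_average_cong_AE[of N n g f z R r] N g eq r R by (simp add: I_def G_def)
  have "ennreal (LINT x:cbox z (z + vec R)|lborel. I x) = (\<integral>\<^sup>+x\<in>cbox z (z + vec R). ennreal (I x) \<partial>lborel)"
    using I0 I1 emeasure_lborel_cbox_finite by (intro ennreal_set_integral) auto
  then show ?eq
    unfolding avg I_nn by (simp add: G_def)
  have "0 \<le> (LINT x:cbox z (z + vec R)|lborel. I x)"
    unfolding set_lebesgue_integral_def using I0 by (intro integral_nonneg_AE) auto
  moreover have "0 < (2 * r) ^ (2 * n) * R^2"
    using r R by simp
  ultimately show ?nonneg
    unfolding avg[symmetric] by (metis zero_le_mult_iff not_le)
qed

section \<open>Counting cubes\<close>

text \<open>The convex function \<open>t ^ Suc k\<close> lies above its tangent at \<open>a\<close>.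
  The induction multiplies the previous inequality by \<open>t\<close> and adds a nonnegative
  multiple of \<open>(t - a)\<^sup>2\<close>.\<close>

lemma power_tangent_le:
  fixes a t :: real
  assumes "0 \<le> a" "0 \<le> t"
  shows "real (Suc k) * a ^ k * t \<le> t ^ Suc k + real k * a ^ Suc k"
proof (induction k)
  case 0
  then show ?case by simp
next
  case (Suc k)
  have "0 \<le> real (Suc k) * a ^ k * (t - a)\<^sup>2"
    using assms by simp
  moreover have "t * (real (Suc k) * a ^ k * t) \<le> t * (t ^ Suc k + real k * a ^ Suc k)"
    using Suc assms(2) by (rule mult_left_mono)
  ultimately show ?case
    by (simp add: algebra_simps power2_eq_square)
qed

text \<open>Jensen's inequality for \<open>t ^ m\<close>, from integrating the tangent inequality at
  \<open>a\<close>. Only a lower bound \<open>a\<close> for the mean is required, since the tangent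
  has nonnegative slope.\<close>

lemma power_mean_nn_integral:
  fixes f :: "'a \<Rightarrow> real"
  assumes [measurable]: "f \<in> borel_measurable M" "S \<in> sets M"
    and f: "\<And>x. 0 \<le> f x" and a: "0 \<le> a" and fin: "emeasure M S < \<infinity>"
    and mean: "ennreal a * emeasure M S \<le> (\<integral>\<^sup>+x\<in>S. ennreal (f x) \<partial>M)"
  shows "ennreal (a ^ m) * emeasure M S \<le> (\<integral>\<^sup>+x\<in>S. ennreal (f x ^ m) \<partial>M)"
proof (cases m)
  case 0
  then show ?thesis by simp
next
  case (Suc k)
  let ?c = "real (Suc k) * a ^ k" and ?d = "real k * a ^ Suc k"
  \<comment> \<open>The constant term of the tangent stays on both sides to avoid subtraction in
    \<open>ennreal\<close>; it is finite and cancels at the end.\<close>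
  have "ennreal (a ^ m) * emeasure M S + ennreal ?d * emeasure M S = ennreal ?c * (ennreal a * emeasure M S)"
  proof -
    have "?c * a = a ^ m + ?d"
      by (simp add: Suc algebra_simps)
    then have "ennreal ?c * ennreal a = ennreal (a ^ m) + ennreal ?d"
      using a by (simp flip: ennreal_mult ennreal_plus)
    then show ?thesis
      by (simp only: mult.assoc[symmetric] distrib_right)
  qed
  also have "\<dots> \<le> ennreal ?c * (\<integral>\<^sup>+x\<in>S. ennreal (f x) \<partial>M)"
    by (rule mult_left_mono[OF mean]) simp
  also have "\<dots> = (\<integral>\<^sup>+x\<in>S. ennreal (?c * f x) \<partial>M)"
    using a f by (subst nn_integral_cmult[symmetric]) (auto simp: ennreal_mult mult.assoc)
  also have "\<dots> \<le> (\<integral>\<^sup>+x\<in>S. (ennreal (f x ^ m) + ennreal ?d) \<partial>M)"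
    using a f power_tangent_le[of a _ k]
    by (intro nn_integral_mono mult_right_mono) (auto simp: Suc simp flip: ennreal_plus intro!: ennreal_leI)
  also have "\<dots> = (\<integral>\<^sup>+x\<in>S. ennreal (f x ^ m) \<partial>M) + ennreal ?d * emeasure M S"
    by (simp add: distrib_right nn_integral_add nn_integral_cmult)
  finally show ?thesis
    using fin by (auto simp: ennreal_mult_eq_top_iff)
qed

section \<open>Intersections of a set with its translates\<close>

definition self_shift :: "(real^2) set \<Rightarrow> real^2 \<Rightarrow> (real^2) set" where
  "self_shift B w = {x \<in> B. x + w \<in> B}"

lemma sets_self_shift [measurable]:
  assumes [measurable]: "B \<in> sets borel"
  shows "self_shift B w \<in> sets borel"
  unfolding self_shift_def by measurable

lemma indicator_self_shift: "(indicator (self_shift B w) x :: 'a::semiring_1) = indicator B x * indicator B (x + w)"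
  by (auto simp: self_shift_def indicator_def)

lemma borel_measurable_emeasure_self_shift [measurable]:
  assumes [measurable]: "B \<in> sets borel"
  shows "(\<lambda>w. emeasure lborel (self_shift B w)) \<in> borel_measurable borel"
proof -
  have "(\<lambda>w. emeasure lborel (self_shift B w)) =
      (\<lambda>w. \<integral>\<^sup>+x. indicator B x * indicator B (x + w) \<partial>lborel)"
    by (simp flip: indicator_self_shift)
  then show ?thesis by simp
qed

text \<open>Let h(c) be the measure of \<open>B\<close> in c + [0,r]^2. Its integral is r^2 |B| and
  its support lies in a square of side 2R, so the integral of h^2 is at least r^2 |B|^2 / (4 R^2)
  times r^2. Expanding h^2 counts pairs of points of \<open>B\<close> in a common small square;
  their difference lies in [-r,r]^2, which bounds the same integral by r^2 times the right-hand
  side.\<close>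

lemma self_shift_mean:
  assumes [measurable]: "B \<in> sets borel" and B: "B \<subseteq> cbox z (z + vec R)" and r: "0 < r" "r \<le> R"
  shows "ennreal ((measure lborel B)\<^sup>2 / (16 * R\<^sup>2)) * emeasure lborel (cbox (vec (- r)) (vec r) :: (real^2) set)
    \<le> (\<integral>\<^sup>+w\<in>cbox (vec (- r)) (vec r). emeasure lborel (self_shift B w) \<partial>lborel)"
proof -
  let ?P = "cbox (vec (- r)) (vec r) :: (real^2) set" and ?Q = "cbox 0 (vec r) :: (real^2) set"
  \<comment> \<open>Since \<open>r \<le> R\<close>, this contains every corner \<open>c\<close> for
    which c + [0,r]^2 can meet the square around \<open>B\<close>.\<close>
  let ?C = "cbox (z - vec R) (z + vec R)"
  have "emeasure lborel B \<le> emeasure lborel (cbox z (z + vec R))"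
    using B by (intro emeasure_mono) auto
  then have Bfin: "emeasure lborel B < \<infinity>"
    using emeasure_lborel_cbox_finite by (rule order.strict_trans1)
  define m where "m = measure lborel B"
  have m: "emeasure lborel B = ennreal m" "0 \<le> m"
    using Bfin by (auto simp: m_def emeasure_eq_ennreal_measure)
  define h where "h c = (\<integral>\<^sup>+x. indicator B x * indicator ?Q (x - c) \<partial>lborel)" for c
  have [measurable]: "h \<in> borel_measurable borel"
    unfolding h_def by measurable
  have "h c \<le> emeasure lborel B" for c
  proof -
    have "h c \<le> (\<integral>\<^sup>+x. indicator B x \<partial>lborel)"
      unfolding h_def by (intro nn_integral_mono) (auto simp: indicator_def)
    then show ?thesis by simp
  qed
  then have hfin: "h c < top" for c
    using order.strict_trans1[OF _ Bfin, of "h c"] by simp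
  have Q: "(\<integral>\<^sup>+c. indicator ?Q (x - c) \<partial>lborel) = ennreal (r\<^sup>2)" for x
  proof -
    have "(\<integral>\<^sup>+c. indicator ?Q (x - c) \<partial>lborel) = (\<integral>\<^sup>+c. indicator (cbox (x - vec r) ((x - vec r) + vec r)) c \<partial>lborel)"
      by (intro nn_integral_cong) (auto simp: indicator_def mem_box_cart algebra_simps)
    then show ?thesis
      using r emeasure_square[of r "x - vec r"] by simp
  qed
  have supp: "h c = 0" if "c \<notin> ?C" for c
  proof -
    have "x \<notin> B \<or> x - c \<notin> ?Q" for x
    proof (rule ccontr)
      assume *: "\<not> (x \<notin> B \<or> x - c \<notin> ?Q)"
      then have "x \<in> cbox z (z + vec R)" using B by auto
      with * r have "c \<in> ?C"
        by (auto simp: mem_box_cart) (smt (verit))+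
      with that show False ..
    qed
    then have "(\<lambda>x. indicator B x * indicator ?Q (x - c)) = (\<lambda>_. 0 :: ennreal)"
      by (auto simp: fun_eq_iff indicator_def)
    then show ?thesis
      unfolding h_def by (simp only: nn_integral_const mult_zero_left)
  qed
  have C: "emeasure lborel ?C = ennreal (4 * R\<^sup>2)"
  proof -
    have "?C = cbox (z - vec R) ((z - vec R) + vec (2 * R))"
      by (rule arg_cong2[where f = cbox]) (auto simp: vec_eq_iff)
    then show ?thesis
      using emeasure_square[of "2 * R" "z - vec R"] r by (simp add: power_mult_distrib)
  qed
  \<comment> \<open>The mean of \<open>h\<close> over \<open>?C\<close>: total mass r^2 m divided by
    the area 4 R^2.\<close>
  define a where "a = r\<^sup>2 * m / (4 * R\<^sup>2)"
  have a: "0 \<le> a" using m by (simp add: a_def)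
  have "(\<integral>\<^sup>+c\<in>?C. h c \<partial>lborel) = (\<integral>\<^sup>+c. h c \<partial>lborel)"
    using supp by (intro nn_integral_cong) (auto simp: indicator_def)
  also have "\<dots> = (\<integral>\<^sup>+x. \<integral>\<^sup>+c. indicator B x * indicator ?Q (x - c) \<partial>lborel \<partial>lborel)"
    unfolding h_def by (rule lborel_pair.Fubini') measurable
  also have "\<dots> = ennreal (r\<^sup>2) * emeasure lborel B"
    by (simp add: nn_integral_cmult Q nn_integral_multc mult.commute)
  also have "\<dots> = ennreal a * emeasure lborel ?C"
    using r m by (simp add: C a_def flip: ennreal_mult)
  finally have mean: "ennreal a * emeasure lborel ?C \<le> (\<integral>\<^sup>+c\<in>?C. ennreal (enn2real (h c)) \<partial>lborel)"
    using hfin by simp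
  define g where "g x = (\<integral>\<^sup>+w. indicator ?P w * indicator B (x + w) \<partial>lborel)" for x
  have [measurable]: "g \<in> borel_measurable borel"
    unfolding g_def by measurable
  \<comment> \<open>Two points of c + [0,r]^2 differ by a vector of [-r,r]^2, so \<open>g x\<close>,
    the measure of \<open>B\<close> in x + [-r,r]^2, dominates \<open>h c\<close>.\<close>
  have hg: "h c \<le> g x" if "x - c \<in> ?Q" for x c
  proof -
    have "h c \<le> (\<integral>\<^sup>+y. indicator ?P (y - x) * indicator B y \<partial>lborel)"
      unfolding h_def
    proof (rule nn_integral_mono)
      fix y
      have "y - x \<in> ?P" if "y - c \<in> ?Q"
        using that \<open>x - c \<in> ?Q\<close> by (auto simp: mem_box_cart) (smt (verit))+
      then show "(indicator B y * indicator ?Q (y - c) :: ennreal) \<le> indicator ?P (y - x) * indicator B y"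
        by (auto simp: indicator_def)
    qed
    also have "\<dots> = g x"
      unfolding g_def using nn_integral_lborel_translate[of "\<lambda>y. indicator ?P (y - x) * indicator B y" x]
      by simp
    finally show ?thesis .
  qed
  have "ennreal (a\<^sup>2) * emeasure lborel ?C \<le> (\<integral>\<^sup>+c\<in>?C. ennreal ((enn2real (h c))\<^sup>2) \<partial>lborel)"
    using mean a C by (intro power_mean_nn_integral) auto
  also have "\<dots> \<le> (\<integral>\<^sup>+c. h c * h c \<partial>lborel)"
  proof (rule nn_integral_mono)
    fix c
    have "ennreal ((enn2real (h c))\<^sup>2) = h c * h c"
      using hfin[of c] by (simp add: power2_eq_square ennreal_mult)
    then show "ennreal ((enn2real (h c))\<^sup>2) * indicator ?C c \<le> h c * h c"
      by (auto simp: indicator_def)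
  qed
  \<comment> \<open>One factor \<open>h c\<close> is expanded as an integral over \<open>x\<close>;
    wherever its integrand is nonzero, \<open>hg\<close> replaces the other factor by
    \<open>g x\<close>, which no longer depends on \<open>c\<close>.\<close>
  also have "\<dots> \<le> (\<integral>\<^sup>+c. \<integral>\<^sup>+x. indicator B x * indicator ?Q (x - c) * g x \<partial>lborel \<partial>lborel)"
  proof (rule nn_integral_mono)
    fix c
    have "h c * h c = (\<integral>\<^sup>+x. indicator B x * indicator ?Q (x - c) * h c \<partial>lborel)"
      by (subst nn_integral_multc) (auto simp: h_def)
    also have "\<dots> \<le> (\<integral>\<^sup>+x. indicator B x * indicator ?Q (x - c) * g x \<partial>lborel)"
      using hg by (intro nn_integral_mono) (auto simp: indicator_def)
    finally show "h c * h c \<le> (\<integral>\<^sup>+x. indicator B x * indicator ?Q (x - c) * g x \<partial>lborel)" .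
  qed
  also have "\<dots> = (\<integral>\<^sup>+x. \<integral>\<^sup>+c. indicator B x * indicator ?Q (x - c) * g x \<partial>lborel \<partial>lborel)"
    by (rule lborel_pair.Fubini') measurable
  also have "\<dots> = (\<integral>\<^sup>+x. ennreal (r\<^sup>2) * (indicator B x * g x) \<partial>lborel)"
    by (simp add: nn_integral_cmult nn_integral_multc Q ac_simps)
  also have "\<dots> = ennreal (r\<^sup>2) * (\<integral>\<^sup>+x. indicator B x * g x \<partial>lborel)"
    by (simp add: nn_integral_cmult)
  also have "(\<integral>\<^sup>+x. indicator B x * g x \<partial>lborel) =
      (\<integral>\<^sup>+x. \<integral>\<^sup>+w. indicator B x * (indicator ?P w * indicator B (x + w)) \<partial>lborel \<partial>lborel)"
    unfolding g_def by (simp add: nn_integral_cmult)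
  also have "\<dots> = (\<integral>\<^sup>+w. \<integral>\<^sup>+x. indicator B x * (indicator ?P w * indicator B (x + w)) \<partial>lborel \<partial>lborel)"
    by (rule lborel_pair.Fubini') measurable
  also have "\<dots> = (\<integral>\<^sup>+w\<in>?P. emeasure lborel (self_shift B w) \<partial>lborel)"
    by (intro nn_integral_cong, subst nn_integral_indicator[symmetric], simp,
        subst nn_integral_multc[symmetric], simp, simp add: indicator_self_shift ac_simps)
  finally have *: "ennreal (a\<^sup>2) * emeasure lborel ?C \<le>
      ennreal (r\<^sup>2) * (\<integral>\<^sup>+w\<in>?P. emeasure lborel (self_shift B w) \<partial>lborel)" .
  \<comment> \<open>The constant 16 is the area factor 4 of \<open>?C\<close> times the area factor
    4 of \<open>?P\<close>.\<close>
  have "ennreal (a\<^sup>2) * emeasure lborel ?C = ennreal (r\<^sup>2) * (ennreal (m\<^sup>2 / (16 * R\<^sup>2)) * emeasure lborel ?P)"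
    using r m by (simp add: C emeasure_centered_square a_def field_simps power2_eq_square flip: ennreal_mult)
  with * r show ?thesis
    by (simp add: m_def ennreal_mult_le_mult_iff)
qed

section \<open>The measure of the cubes contained in a set\<close>

definition cube_measure :: "nat \<Rightarrow> real \<Rightarrow> (real^2) set \<Rightarrow> ennreal" where
  "cube_measure n r B = (\<integral>\<^sup>+x. (\<integral>\<^sup>+v\<in>shifts n r.
     (\<Prod>\<eta>\<in>bin_cube n. indicator B (vertex n \<eta> x v)) \<partial>shift_space n) \<partial>lborel)"

lemma measurable_prod_vertex:
  assumes [measurable]: "B \<in> sets borel"
  shows "(\<lambda>p. \<Prod>\<eta>\<in>bin_cube n. indicator B (vertex n \<eta> (fst p) (snd p)) :: ennreal)
    \<in> borel_measurable (lborel \<Otimes>\<^sub>M shift_space n)"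
  by measurable

lemma cube_measure_0: "B \<in> sets borel \<Longrightarrow> cube_measure 0 r B = emeasure lborel B"
  by (simp add: cube_measure_def PiM_empty nn_integral_count_space_finite bin_cube_def lessThan_0)

text \<open>A cube with last shift \<open>w\<close> lies in \<open>B\<close> exactly when its face
  without that shift lies in B \<inter> (B - w).\<close>

lemma prod_vertex_Suc:
  "(\<Prod>\<eta>\<in>bin_cube (Suc n). indicator B (vertex (Suc n) \<eta> x (v(n := w)))) =
    (\<Prod>\<eta>\<in>bin_cube n. indicator (self_shift B w) (vertex n \<eta> x v) :: 'a::comm_semiring_1)"
proof -
  have sum: "(\<Sum>i<n. real ((\<eta>(n := k)) i) *\<^sub>R (v(n := w)) i) = (\<Sum>i<n. real (\<eta> i) *\<^sub>R v i)" for \<eta> k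
    by (rule sum.cong) auto
  have "vertex (Suc n) (\<eta>(n := k)) x (v(n := w)) = vertex n \<eta> x v + real k *\<^sub>R w" for \<eta> k
    unfolding sum.lessThan_Suc sum by (simp add: add.assoc)
  then show ?thesis
    unfolding prod_bin_cube_Suc by (simp only: indicator_self_shift) simp
qed

text \<open>Tonelli brings the last shift outermost, and \<open>prod_vertex_Suc\<close> identifies
  what remains for each fixed \<open>w\<close>.\<close>

lemma cube_measure_Suc:
  assumes B [measurable]: "B \<in> sets borel"
  shows "cube_measure (Suc n) r B =
    (\<integral>\<^sup>+w\<in>cbox (vec (- r)) (vec r). cube_measure n r (self_shift B w) \<partial>lborel)"
proof -
  interpret V: sigma_finite_measure "shift_space n" by (rule sigma_finite_shift_space)
  let ?P = "cbox (vec (- r)) (vec r) :: (real^2) set"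
  define G where "G x v = (\<Prod>\<eta>\<in>bin_cube (Suc n). indicator B (vertex (Suc n) \<eta> x v) :: ennreal)" for x v
  define H where "H w x v = (\<Prod>\<eta>\<in>bin_cube n. indicator (self_shift B w) (vertex n \<eta> x v) :: ennreal)" for w x v
  have Gm: "G x \<in> borel_measurable (shift_space (Suc n))" for x
    unfolding G_def using measurable_compose[OF measurable_Pair1' measurable_prod_vertex[OF B], of x] by simp
  have shifts_Suc: "v(n := w) \<in> shifts (Suc n) r \<longleftrightarrow> v \<in> shifts n r \<and> w \<in> ?P" if "v \<in> space (shift_space n)" for v w
    using that by (auto simp: space_PiM PiE_def Pi_def extensional_def less_Suc_eq)
  have "(\<integral>\<^sup>+v\<in>shifts (Suc n) r. G x v \<partial>shift_space (Suc n)) =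
      (\<integral>\<^sup>+w. \<integral>\<^sup>+v. indicator ?P w * (H w x v * indicator (shifts n r) v) \<partial>shift_space n \<partial>lborel)" for x
  proof -
    have "(\<integral>\<^sup>+v\<in>shifts (Suc n) r. G x v \<partial>shift_space (Suc n)) =
        (\<integral>\<^sup>+w. \<integral>\<^sup>+v. G x (v(n := w)) * indicator (shifts (Suc n) r) (v(n := w)) \<partial>shift_space n \<partial>lborel)"
      unfolding lessThan_Suc
      by (rule lborel_PiM.product_nn_integral_insert_rev) (use Gm sets_shifts[of "Suc n"] in \<open>auto simp: lessThan_Suc\<close>)
    also have "\<dots> = (\<integral>\<^sup>+w. \<integral>\<^sup>+v. indicator ?P w * (H w x v * indicator (shifts n r) v) \<partial>shift_space n \<partial>lborel)"
    proof (intro nn_integral_cong)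
      fix w v assume "v \<in> space (shift_space n)"
      then have ind: "indicator (shifts (Suc n) r) (v(n := w)) = (indicator ?P w * indicator (shifts n r) v :: ennreal)"
        by (auto simp: shifts_Suc indicator_def)
      show "G x (v(n := w)) * indicator (shifts (Suc n) r) (v(n := w)) =
          indicator ?P w * (H w x v * indicator (shifts n r) v)"
        unfolding G_def H_def prod_vertex_Suc
          by (simp only: ind ac_simps)
    qed
    finally show ?thesis .
  qed
  then have "cube_measure (Suc n) r B =
      (\<integral>\<^sup>+x. \<integral>\<^sup>+w. \<integral>\<^sup>+v. indicator ?P w * (H w x v * indicator (shifts n r) v) \<partial>shift_space n \<partial>lborel \<partial>lborel)"
    by (simp add: cube_measure_def G_def)
  also have "\<dots> = (\<integral>\<^sup>+w. \<integral>\<^sup>+x. \<integral>\<^sup>+v. indicator ?P w * (H w x v * indicator (shifts n r) v) \<partial>shift_space n \<partial>lborel \<partial>lborel)"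
    unfolding H_def indicator_self_shift by (rule lborel_pair.Fubini') measurable
  also have "\<dots> = (\<integral>\<^sup>+w\<in>?P. cube_measure n r (self_shift B w) \<partial>lborel)"
    unfolding cube_measure_def H_def[symmetric]
    by (intro nn_integral_cong) (simp add: indicator_def)
  finally show ?thesis .
qed

text \<open>Induction on \<open>n\<close> for all \<open>B\<close> in the same square, since
  \<open>self_shift B w\<close> stays in it. Raising the mean bound of
  \<open>self_shift_mean\<close> to the power \<open>2 ^ n\<close> contributes \<open>2 ^ n\<close>
  further factors 16 R^2, whence the exponent \<open>2 ^ n - 1\<close>.\<close>

lemma cube_measure_ge:
  assumes "B \<in> sets borel" and "B \<subseteq> cbox z (z + vec R)" and r: "0 < r" "r \<le> R"
  shows "ennreal ((2 * r) ^ (2 * n) / (16 * R\<^sup>2) ^ (2 ^ n - 1) * measure lborel B ^ (2 ^ n)) \<le> cube_measure n r B"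
  using assms(1,2)
proof (induction n arbitrary: B)
  case 0
  have "emeasure lborel B \<le> emeasure lborel (cbox z (z + vec R))"
    using 0 by (intro emeasure_mono) auto
  then have "emeasure lborel B < \<infinity>"
    using emeasure_lborel_cbox_finite by (rule order.strict_trans1)
  then show ?case
    using 0 by (simp add: cube_measure_0 emeasure_eq_ennreal_measure)
next
  case (Suc n)
  note [measurable] = Suc.prems(1)
  let ?P = "cbox (vec (- r)) (vec r) :: (real^2) set"
  let ?K = "(2 * r) ^ (2 * n) / (16 * R\<^sup>2) ^ (2 ^ n - 1)"
  let ?a = "(measure lborel B)\<^sup>2 / (16 * R\<^sup>2)"
  have fin: "emeasure lborel (self_shift B w) < \<infinity>" for w
  proof -
    have "self_shift B w \<subseteq> cbox z (z + vec R)"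
      using Suc.prems(2) by (auto simp: self_shift_def)
    then have "emeasure lborel (self_shift B w) \<le> emeasure lborel (cbox z (z + vec R))"
      by (intro emeasure_mono) auto
    then show ?thesis
      using emeasure_lborel_cbox_finite by (rule order.strict_trans1)
  qed
  have [measurable]: "(\<lambda>w. measure lborel (self_shift B w)) \<in> borel_measurable lborel"
    unfolding measure_def by measurable
  \<comment> \<open>Writing \<open>2 ^ n\<close> as a successor removes the truncated subtraction
    from the exponents.\<close>
  obtain q where q: "(2::nat) ^ n = Suc q"
    by (metis not0_implies_Suc power_not_zero zero_neq_numeral)
  then have "(2::nat) ^ n - 1 = q" "(2::nat) ^ Suc n - 1 = q + Suc q" "(2::nat) ^ Suc n = 2 * Suc q"
    by auto
  then have "(2 * r) ^ (2 * Suc n) / (16 * R\<^sup>2) ^ (2 ^ Suc n - 1) * measure lborel B ^ (2 ^ Suc n) =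
      ?K * (?a ^ (2 ^ n) * (2 * r)\<^sup>2)"
    unfolding q
    by (simp only: mult_Suc_right power_add power_divide flip: power_mult) (simp add: ac_simps)
  then have "ennreal ((2 * r) ^ (2 * Suc n) / (16 * R\<^sup>2) ^ (2 ^ Suc n - 1) * measure lborel B ^ (2 ^ Suc n)) =
      ennreal ?K * (ennreal (?a ^ (2 ^ n)) * emeasure lborel ?P)"
    using r by (simp add: emeasure_centered_square flip: ennreal_mult)
  \<comment> \<open>The power mean inequality with exponent \<open>2 ^ n\<close>, where
    \<open>?a\<close> is the lower bound for the mean of |B \<inter> (B - w)| over
    \<open>?P\<close>.\<close>
  also have "\<dots> \<le> ennreal ?K * (\<integral>\<^sup>+w\<in>?P. ennreal (measure lborel (self_shift B w) ^ (2 ^ n)) \<partial>lborel)"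
  proof (intro mult_left_mono power_mean_nn_integral)
    show "ennreal ?a * emeasure lborel ?P \<le> (\<integral>\<^sup>+w\<in>?P. ennreal (measure lborel (self_shift B w)) \<partial>lborel)"
      using self_shift_mean[OF Suc.prems r] fin by (simp add: emeasure_eq_ennreal_measure less_top)
  qed (auto simp: emeasure_lborel_cbox_eq)
  also have "\<dots> = (\<integral>\<^sup>+w\<in>?P. ennreal (?K * measure lborel (self_shift B w) ^ (2 ^ n)) \<partial>lborel)"
  proof -
    have K: "0 \<le> ?K" using r by simp
    show ?thesis
      by (subst nn_integral_cmult[symmetric], measurable) (simp only: ennreal_mult'[OF K] mult.assoc)
  qed
  also have "\<dots> \<le> (\<integral>\<^sup>+w\<in>?P. cube_measure n r (self_shift B w) \<partial>lborel)"
    using Suc.prems by (intro nn_integral_mono mult_right_mono Suc.IH) (auto simp: self_shift_def)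
  also have "\<dots> = cube_measure (Suc n) r B"
    using Suc.prems by (simp add: cube_measure_Suc)
  finally show ?case .
qed

section \<open>Bounds for the densities\<close>

text \<open>A Lebesgue set is a Borel set up to a null set, and one null set \<open>N\<close> serves
  all indices at once.\<close>

lemma borel_family:
  fixes A :: "(real^2) set"
  assumes A: "A \<in> sets lebesgue" and f: "\<forall>\<eta>\<in>bin_cube n. f \<eta> \<in> {indicator A, indicator UNIV}"
  obtains B N and g :: "(nat \<Rightarrow> nat) \<Rightarrow> real^2 \<Rightarrow> real"
  where "B \<in> sets borel" and "N \<in> null_sets lborel"
    and "\<And>\<eta>. g \<eta> \<in> {indicator B, indicator UNIV}"
    and "\<And>\<eta>. \<eta> \<in> bin_cube n \<Longrightarrow> f \<eta> = indicator A \<Longrightarrow> g \<eta> = indicator B"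
    and "\<And>\<eta> x. \<eta> \<in> bin_cube n \<Longrightarrow> x \<notin> N \<Longrightarrow> f \<eta> x = g \<eta> x"
    and "\<And>S. S \<in> sets borel \<Longrightarrow> measure lebesgue (A \<inter> S) = measure lborel (B \<inter> S)"
proof -
  obtain B N N' where AB: "A = B \<union> N'" "N' \<subseteq> N" "N \<in> null_sets lborel" "B \<in> sets lborel"
    using A by (rule sets_completionE)
  \<comment> \<open>Indices outside \<open>bin_cube n\<close> may carry arbitrary
    \<open>f \<eta>\<close>; the default \<open>indicator UNIV\<close> keeps every
    \<open>g \<eta>\<close> an indicator.\<close>
  define g where "g \<eta> = (if f \<eta> = indicator A then indicator B else indicator UNIV :: real^2 \<Rightarrow> real)" for \<eta>
  show ?thesis
  proof
    show "B \<in> sets borel" "N \<in> null_sets lborel" using AB by auto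
    show "g \<eta> \<in> {indicator B, indicator UNIV}" for \<eta> by (simp add: g_def)
    show "g \<eta> = indicator B" if "f \<eta> = indicator A" for \<eta> using that by (simp add: g_def)
    show "f \<eta> x = g \<eta> x" if "\<eta> \<in> bin_cube n" "x \<notin> N" for \<eta> x
    proof -
      have "(x \<in> A) = (x \<in> B)" using AB that by auto
      then show ?thesis
        using f that by (auto simp: g_def indicator_def)
    qed
    show "measure lebesgue (A \<inter> S) = measure lborel (B \<inter> S)" if S: "S \<in> sets borel" for S
    proof -
      have "AE x in lebesgue. x \<in> A \<inter> S \<longleftrightarrow> x \<in> B \<inter> S"
        using AE_completion[OF AE_not_in[OF AB(3)]] by eventually_elim (use AB in auto)
      then have "measure lebesgue (A \<inter> S) = measure lebesgue (B \<inter> S)"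
        using A AB S by (intro measure_eq_AE) auto
      then show ?thesis using AB S by simp
    qed
  qed
qed

text \<open>Both bounds hold at every scale \<open>r \<le> R\<close> before any limit is taken. They
  are uniform in \<open>r\<close>, and the lower one keeps the density of the same square, so it
  survives the infimum over \<open>r\<close> and the supremum over \<open>z\<close>.\<close>

lemma box_average_bounds:
  fixes A :: "(real^2) set"
  assumes A: "A \<in> sets lebesgue" and f: "\<forall>\<eta>\<in>bin_cube n. f \<eta> \<in> {indicator A, indicator UNIV}"
    and r: "0 < r" "r \<le> R"
  shows box_average_lower:
      "(measure lebesgue (A \<inter> cbox z (z + vec R)) / R\<^sup>2) ^ (2 ^ n) / 16 ^ (2 ^ n - 1) \<le> box_average n f z R r"
    and box_average_upper: "\<lbrakk>\<theta> \<in> bin_cube n; f \<theta> = indicator A;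
      \<And>y. measure lebesgue (A \<inter> cbox y (y + vec R)) / R\<^sup>2 \<le> D\<rbrakk> \<Longrightarrow> box_average n f z R r \<le> D"
proof -
  obtain B N g where [measurable]: "B \<in> sets borel" and N: "N \<in> null_sets lborel"
    and g: "\<And>\<eta>. g \<eta> \<in> {indicator B, indicator UNIV :: real^2 \<Rightarrow> real}"
    and gB: "\<And>\<eta>. \<eta> \<in> bin_cube n \<Longrightarrow> f \<eta> = indicator A \<Longrightarrow> g \<eta> = indicator B"
    and fg: "\<And>\<eta> x. \<eta> \<in> bin_cube n \<Longrightarrow> x \<notin> N \<Longrightarrow> f \<eta> x = g \<eta> x"
    and AB: "\<And>S. S \<in> sets borel \<Longrightarrow> measure lebesgue (A \<inter> S) = measure lborel (B \<inter> S)"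
    using borel_family[OF A f] by blast
  interpret V: sigma_finite_measure "shift_space n" by (rule sigma_finite_shift_space)
  interpret LV: pair_sigma_finite lborel "shift_space n" ..
  let ?Box = "cbox z (z + vec R)"
  have R: "0 < R" using r by simp
  have g01: "0 \<le> g \<eta> x" "g \<eta> x \<le> 1" for \<eta> x
    using g[of \<eta>] by (auto simp: indicator_def)
  have gm: "g \<eta> \<in> borel_measurable borel" for \<eta>
    using g[of \<eta>] by auto
  have nonneg: "0 \<le> box_average n f z R r"
    by (rule box_average_nn(1)[OF N gm g01 fg r(1) R])
  have average: "ennreal ((2 * r) ^ (2 * n) * R^2 * box_average n f z R r) =
      (\<integral>\<^sup>+x\<in>?Box. (\<integral>\<^sup>+v\<in>shifts n r.
        ennreal (\<Prod>\<eta>\<in>bin_cube n. g \<eta> (vertex n \<eta> x v)) \<partial>shift_space n) \<partial>lborel)"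
    by (rule box_average_nn(2)[OF N gm g01 fg r(1) R])
  define m where "m = measure lborel (B \<inter> ?Box)"
  have "ennreal ((2 * r) ^ (2 * n) / (16 * R\<^sup>2) ^ (2 ^ n - 1) * m ^ (2 ^ n)) \<le> cube_measure n r (B \<inter> ?Box)"
    unfolding m_def by (rule cube_measure_ge) (use r in auto)
  also have "\<dots> \<le> ennreal ((2 * r) ^ (2 * n) * R^2 * box_average n f z R r)"
    unfolding cube_measure_def average
  proof (rule nn_integral_mono)
    fix x
    show "(\<integral>\<^sup>+v\<in>shifts n r. (\<Prod>\<eta>\<in>bin_cube n. indicator (B \<inter> ?Box) (vertex n \<eta> x v)) \<partial>shift_space n) \<le>
      (\<integral>\<^sup>+v\<in>shifts n r. ennreal (\<Prod>\<eta>\<in>bin_cube n. g \<eta> (vertex n \<eta> x v)) \<partial>shift_space n) * indicator ?Box x"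
    proof (cases "x \<in> ?Box")
      case True
      have "(\<Prod>\<eta>\<in>bin_cube n. indicator (B \<inter> ?Box) (vertex n \<eta> x v)) \<le>
          ennreal (\<Prod>\<eta>\<in>bin_cube n. g \<eta> (vertex n \<eta> x v))" for v
      proof -
        have "indicat_real (B \<inter> ?Box) y \<le> g \<eta> y" for \<eta> y
          using g[of \<eta>] by (auto simp: indicator_def)
        then have "(\<Prod>\<eta>\<in>bin_cube n. indicat_real (B \<inter> ?Box) (vertex n \<eta> x v)) \<le>
            (\<Prod>\<eta>\<in>bin_cube n. g \<eta> (vertex n \<eta> x v))"
          by (intro prod_mono) simp
        then show ?thesis
          by (simp only: ennreal_indicator[symmetric] prod_ennreal indicator_pos_le ennreal_leI)
      qed
      then show ?thesis
        using True by (auto intro!: nn_integral_mono mult_right_mono)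
    next
      \<comment> \<open>The zero vertex is \<open>x\<close> itself, so no cube in B \<inter> ?Box
        starts outside the square. Integrating \<open>x\<close> over the whole plane in
        \<open>cube_measure\<close> thus adds nothing.\<close>
      case False
      let ?o = "restrict (\<lambda>_. 0) {..<n} :: nat \<Rightarrow> nat"
      have "?o \<in> bin_cube n" by (auto simp: bin_cube_def)
      moreover have "vertex n ?o x v = x" for v by simp
      ultimately have "(\<Prod>\<eta>\<in>bin_cube n. indicator (B \<inter> ?Box) (vertex n \<eta> x v)) = (0 :: ennreal)" for v
        using False by (intro prod_zero bexI[of _ ?o]) auto
      then show ?thesis by (simp only: mult_zero_left nn_integral_const zero_le)
    qed
  qed
  finally have "(2 * r) ^ (2 * n) / (16 * R\<^sup>2) ^ (2 ^ n - 1) * m ^ (2 ^ n) \<le>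
      (2 * r) ^ (2 * n) * R^2 * box_average n f z R r"
    using nonneg r by (subst (asm) ennreal_le_iff) auto
  then have "(2 * r) ^ (2 * n) * (m ^ (2 ^ n) / (16 * R\<^sup>2) ^ (2 ^ n - 1)) \<le>
      (2 * r) ^ (2 * n) * (R^2 * box_average n f z R r)"
    by (simp only: mult.assoc times_divide_eq_left times_divide_eq_right)
  then have "m ^ (2 ^ n) / (16 * R\<^sup>2) ^ (2 ^ n - 1) \<le> R^2 * box_average n f z R r"
    using r by (subst (asm) mult_le_cancel_left_pos) auto
  moreover obtain q where q: "(2::nat) ^ n = Suc q"
    by (metis not0_implies_Suc power_not_zero zero_neq_numeral)
  \<comment> \<open>With \<open>2 ^ n = Suc q\<close>, the powers of R^2 combine as R^2 (16 R^2)^q =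
    16^q (R^2)^(q + 1).\<close>
  ultimately have "(m / R\<^sup>2) ^ (2 ^ n) / 16 ^ (2 ^ n - 1) \<le> box_average n f z R r"
    using R unfolding q by (simp add: field_simps power_divide power_mult_distrib)
  then show "(measure lebesgue (A \<inter> ?Box) / R\<^sup>2) ^ (2 ^ n) / 16 ^ (2 ^ n - 1) \<le> box_average n f z R r"
    by (simp add: m_def AB)
  show "box_average n f z R r \<le> D"
    if \<theta>: "\<theta> \<in> bin_cube n" "f \<theta> = indicator A"
      and D: "\<And>y. measure lebesgue (A \<inter> cbox y (y + vec R)) / R\<^sup>2 \<le> D"
  proof -
    have "0 \<le> D" using D[of 0] by (rule order_trans[rotated]) simp
    \<comment> \<open>For a fixed total shift \<open>w\<close>, translation turns the slice into the
      part of \<open>B\<close> in the square based at \<open>z + w\<close>, which is why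
      \<open>D\<close> must bound the density in all squares of side \<open>R\<close>.\<close>
    have slice: "(\<integral>\<^sup>+x. indicator ?Box x * indicator B (x + w) \<partial>lborel) \<le> ennreal (D * R\<^sup>2)" for w
    proof -
      let ?S = "B \<inter> cbox (z + w) (z + w + vec R)"
      have "(\<integral>\<^sup>+x. indicator ?Box x * indicator B (x + w) \<partial>lborel) = (\<integral>\<^sup>+x. indicator ?S (w + x) \<partial>lborel)"
        by (intro nn_integral_cong) (auto simp: indicator_def mem_box_cart ac_simps)
      also have "\<dots> = emeasure lborel ?S"
        using nn_integral_lborel_translate[of "indicator ?S" w] by simp
      also have "\<dots> = ennreal (measure lborel ?S)"
      proof (rule emeasure_eq_ennreal_measure)
        have "emeasure lborel ?S \<le> emeasure lborel (cbox (z + w) (z + w + vec R))"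
          by (intro emeasure_mono) auto
        then show "emeasure lborel ?S \<noteq> top"
          using emeasure_lborel_cbox_finite[of "z + w" "z + w + vec R"] by (auto simp: top_unique)
      qed
      also have "\<dots> \<le> ennreal (D * R\<^sup>2)"
        using D[of "z + w"] R by (intro ennreal_leI) (simp add: AB field_simps)
      finally show ?thesis .
    qed
    let ?s = "\<lambda>v. \<Sum>i<n. real (\<theta> i) *\<^sub>R v i"
    have "ennreal ((2 * r) ^ (2 * n) * R^2 * box_average n f z R r) \<le>
       (\<integral>\<^sup>+x. \<integral>\<^sup>+v. indicator (shifts n r) v * (indicator ?Box x * indicator B (x + ?s v)) \<partial>shift_space n \<partial>lborel)"
      unfolding average
    proof (rule nn_integral_mono)
      fix x
      \<comment> \<open>All factors other than that of \<open>\<theta>\<close> lie in [0,1] and are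
        dropped.\<close>
      have "(\<Prod>\<eta>\<in>bin_cube n. g \<eta> (vertex n \<eta> x v)) \<le> indicator B (x + ?s v)" for v
      proof -
        have "(\<Prod>\<eta>\<in>bin_cube n - {\<theta>}. g \<eta> (vertex n \<eta> x v)) \<le> 1"
          using g01 by (intro prod_le_1) auto
        then have "g \<theta> (vertex n \<theta> x v) * (\<Prod>\<eta>\<in>bin_cube n - {\<theta>}. g \<eta> (vertex n \<eta> x v)) \<le> g \<theta> (vertex n \<theta> x v) * 1"
          using g01 by (intro mult_left_mono)
        then show ?thesis
          using gB[OF \<theta>] by (subst prod.remove[OF _ \<theta>(1)]) auto
      qed
      then have "ennreal (\<Prod>\<eta>\<in>bin_cube n. g \<eta> (vertex n \<eta> x v)) \<le> indicator B (x + ?s v)" for v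
        using ennreal_leI by (fastforce simp flip: ennreal_indicator)
      then show "(\<integral>\<^sup>+v\<in>shifts n r. ennreal (\<Prod>\<eta>\<in>bin_cube n. g \<eta> (vertex n \<eta> x v)) \<partial>shift_space n) * indicator ?Box x \<le>
        (\<integral>\<^sup>+v. indicator (shifts n r) v * (indicator ?Box x * indicator B (x + ?s v)) \<partial>shift_space n)"
        by (cases "x \<in> ?Box") (auto intro!: nn_integral_mono mult_left_mono simp: mult.commute)
    qed
    also have "\<dots> = (\<integral>\<^sup>+v. \<integral>\<^sup>+x. indicator (shifts n r) v * (indicator ?Box x * indicator B (x + ?s v)) \<partial>lborel \<partial>shift_space n)"
      by (rule LV.Fubini'[symmetric]) measurable
    also have "\<dots> = (\<integral>\<^sup>+v. indicator (shifts n r) v * (\<integral>\<^sup>+x. (indicator ?Box x * indicator B (x + ?s v)) \<partial>lborel) \<partial>shift_space n)"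
      by (intro nn_integral_cong nn_integral_cmult) measurable
    also have "\<dots> \<le> (\<integral>\<^sup>+v. indicator (shifts n r) v * ennreal (D * R\<^sup>2) \<partial>shift_space n)"
      by (intro nn_integral_mono mult_left_mono slice) auto
    also have "\<dots> = ennreal ((2 * r) ^ (2 * n) * R^2 * D)"
      using r \<open>0 \<le> D\<close> sets_shifts
      by (subst nn_integral_multc) (auto simp: emeasure_shifts ac_simps simp flip: ennreal_mult)
    finally have "(2 * r) ^ (2 * n) * R^2 * box_average n f z R r \<le> (2 * r) ^ (2 * n) * R^2 * D"
      using r \<open>0 \<le> D\<close> by (subst (asm) ennreal_le_iff) auto
    then show ?thesis
      using r by (subst (asm) mult_le_cancel_left_pos) auto
  qed
qed

section \<open>Passage to the limit superior\<close>

lemma square_density_le_1: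
  fixes A :: "(real^2) set"
  assumes "A \<in> sets lebesgue" "0 < R"
  shows "measure lebesgue (A \<inter> cbox z (z + vec R)) / R\<^sup>2 \<le> 1"
proof -
  have "measure lebesgue (A \<inter> cbox z (z + vec R)) \<le> measure lebesgue (cbox z (z + vec R))"
    using assms by (intro measure_mono_fmeasurable) auto
  also have "\<dots> = R\<^sup>2"
    using emeasure_square[of R z] assms by (simp add: measure_def)
  finally show ?thesis
    using assms by simp
qed

text \<open>The extended limit superior lies in [0,1], so \<open>real_of_ereal\<close> loses no
  information.\<close>

lemma upper_Banach_density_Limsup:
  fixes A :: "(real^2) set"
  assumes A: "A \<in> sets lebesgue"
  shows "Limsup at_top (\<lambda>R::real. SUP z. ereal (measure lebesgue (A \<inter> cbox z (z + vec R)) / R^2)) =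
      ereal (upper_Banach_density A)" (is "?L = _")
    and "0 \<le> upper_Banach_density A" and "upper_Banach_density A \<le> 1"
proof -
  let ?D = "\<lambda>R::real. SUP z. ereal (measure lebesgue (A \<inter> cbox z (z + vec R)) / R^2)"
  have "0 \<le> ?D R" for R
    by (rule SUP_upper2[of 0]) auto
  then have "0 \<le> ?L"
    by (intro le_Limsup) auto
  moreover have "eventually (\<lambda>R. ?D R \<le> 1) at_top"
    using eventually_gt_at_top[of 0] by eventually_elim (use square_density_le_1[OF A] in \<open>auto intro!: SUP_least\<close>)
  then have "?L \<le> 1"
    by (rule Limsup_bounded)
  ultimately show "?L = ereal (upper_Banach_density A)" "0 \<le> upper_Banach_density A" "upper_Banach_density A \<le> 1"
    unfolding upper_Banach_density_def by (cases ?L; simp)+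
qed

text \<open>The infimum over \<open>r\<close> is bounded by its value at \<open>r = M\<close>, an
  admissible scale once \<open>R\<close> is at least \<open>2 ^ n * M\<close>.\<close>

lemma family_density_upper:
  fixes A :: "(real^2) set"
  assumes A: "A \<in> sets lebesgue" and f: "\<forall>\<eta>\<in>bin_cube n. f \<eta> \<in> {indicator A, indicator UNIV}"
    and \<theta>: "\<theta> \<in> bin_cube n" "f \<theta> = indicator A"
  shows "family_density n f \<le> ereal (upper_Banach_density A)"
  unfolding family_density_def upper_Banach_density_Limsup(1)[OF A, symmetric]
proof (rule SUP_least, rule Limsup_mono)
  fix M :: real assume "M \<in> {1..}"
  then have M: "1 \<le> M" by simp
  let ?D = "\<lambda>R::real. SUP z. ereal (measure lebesgue (A \<inter> cbox z (z + vec R)) / R^2)"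
  show "\<forall>\<^sub>F R in at_top. (SUP z. INF r\<in>{M..R / 2 ^ n}. ereal (box_average n f z R r)) \<le> ?D R"
    using eventually_ge_at_top[of "2 ^ n * M"]
  proof eventually_elim
    case (elim R)
    have "M \<le> 2 ^ n * M" using M by simp
    then have R: "0 < M" "M \<le> R" "0 < R" using elim M by linarith+
    have "0 \<le> ?D R" by (rule SUP_upper2[of 0]) auto
    moreover have "?D R \<le> 1"
      using square_density_le_1[OF A R(3)] by (auto intro!: SUP_least)
    ultimately obtain d where d: "?D R = ereal d"
      by (cases "?D R") auto
    have "measure lebesgue (A \<inter> cbox y (y + vec R)) / R\<^sup>2 \<le> d" for y
      using SUP_upper[of y UNIV "\<lambda>z. ereal (measure lebesgue (A \<inter> cbox z (z + vec R)) / R^2)"] d by simp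
    then have "box_average n f z R M \<le> d" for z
      by (rule box_average_upper[OF A f R(1,2) \<theta>])
    then show ?case
      unfolding d using elim by (intro SUP_least INF_lower2[of M]) (auto simp: field_simps)
  qed
qed

text \<open>The choice \<open>M = 1\<close> already suffices in the outer supremum. Taking the power
  is interchanged with the limit superior by proving the bound for every \<open>t\<close> below the
  density and letting \<open>t\<close> increase to it.\<close>

lemma family_density_lower:
  fixes A :: "(real^2) set"
  assumes A: "A \<in> sets lebesgue" and f: "\<forall>\<eta>\<in>bin_cube n. f \<eta> \<in> {indicator A, indicator UNIV}"
  shows "ereal (1 / 16 ^ (2 ^ n - 1) * upper_Banach_density A ^ (2 ^ n)) \<le> family_density n f"
proof -
  let ?d = "\<lambda>(R::real) z. measure lebesgue (A \<inter> cbox z (z + vec R)) / R\<^sup>2"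
  let ?T = "\<lambda>t. t ^ (2 ^ n) / 16 ^ (2 ^ n - 1) :: real"
  let ?\<delta> = "upper_Banach_density A"
  let ?F = "\<lambda>R::real. SUP z. INF r\<in>{1..R / 2 ^ n}. ereal (box_average n f z R r)"
  have le: "Limsup at_top ?F \<le> family_density n f"
    unfolding family_density_def by (rule SUP_upper) simp
  \<comment> \<open>For small \<open>R\<close> the range of \<open>r\<close> is empty and the
    infimum is infinite, so this holds for every \<open>R\<close>.\<close>
  have lower: "ereal (?T (?d R z)) \<le> ?F R" for R :: real and z
  proof (rule SUP_upper2[of z], simp, rule INF_greatest)
    fix r assume r: "r \<in> {1..R / 2 ^ n}"
    then have "0 \<le> R"
      by (simp add: order_trans[of _ "r * 2 ^ n"] field_simps)
    then have "R / 2 ^ n \<le> R" by (simp add: divide_le_eq mult_le_cancel_left1)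
    then show "ereal (?T (?d R z)) \<le> ereal (box_average n f z R r)"
      using box_average_lower[OF A f, where r = r and R = R and z = z] r by simp
  qed
  \<comment> \<open>Otherwise, by monotonicity of \<open>?T\<close>, all square densities would
    eventually be at most \<open>t\<close>, forcing the upper density below \<open>t\<close>
    too.\<close>
  have below: "ereal (?T t) \<le> Limsup at_top ?F" if t: "0 \<le> t" "t < ?\<delta>" for t
  proof (rule ccontr)
    assume "\<not> ereal (?T t) \<le> Limsup at_top ?F"
    then have "\<forall>\<^sub>F R in at_top. ?F R < ereal (?T t)"
      by (intro Limsup_lessD) simp
    then have "\<forall>\<^sub>F R in at_top. (SUP z. ereal (?d R z)) \<le> ereal t"
    proof eventually_elim
      case (elim R)
      have "?d R z \<le> t" for z
      proof (rule ccontr)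
        assume "\<not> ?d R z \<le> t"
        then have "?T t \<le> ?T (?d R z)"
          using t by (intro divide_right_mono power_mono) auto
        then show False
          using order.strict_trans1[OF lower elim, of z] by simp
      qed
      then show ?case by (auto intro!: SUP_least)
    qed
    then have "ereal ?\<delta> \<le> ereal t"
      unfolding upper_Banach_density_Limsup(1)[OF A, symmetric] by (rule Limsup_bounded)
    with t show False by simp
  qed
  have "ereal (?T ?\<delta>) \<le> Limsup at_top ?F"
  \<comment> \<open>At density 0 there is no nonnegative \<open>t\<close> to approach from the left;
    then \<open>?T ?\<delta>\<close> is 0 and nonnegativity suffices.\<close>
  proof (cases "?\<delta> = 0")
    case True
    have "0 \<le> ?F R" for R
      by (rule order_trans[OF _ lower[where R = R and z = 0]]) simp
    then have "0 \<le> Limsup at_top ?F"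
      by (intro le_Limsup) auto
    then show ?thesis using True by (simp add: power_0_left zero_ereal_def)
  next
    case False
    then have \<delta>: "0 < ?\<delta>"
      using upper_Banach_density_Limsup(2)[OF A] by simp
    have "((\<lambda>t. ereal (?T t)) \<longlongrightarrow> ereal (?T ?\<delta>)) (at_left ?\<delta>)"
      by (intro tendsto_intros) auto
    moreover have "\<forall>\<^sub>F t in at_left ?\<delta>. ereal (?T t) \<le> Limsup at_top ?F"
      using below by (intro eventually_at_leftI[OF _ \<delta>]) auto
    ultimately show ?thesis
      by (rule tendsto_upperbound) simp
  qed
  with le show ?thesis by simp
qed

theorem proposition3p2:
  fixes n :: nat
  assumes "n \<ge> 1"
  shows "\<exists>c C :: real. 0 < c \<and> 0 < C \<and>
    (\<forall>(A :: (real^2) set) (f :: (nat \<Rightarrow> nat) \<Rightarrow> real^2 \<Rightarrow> real).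
       A \<in> sets lebesgue \<longrightarrow>
       (\<forall>\<eta>\<in>bin_cube n. f \<eta> \<in> {indicator A, indicator UNIV}) \<longrightarrow>
       (\<exists>\<eta>\<in>bin_cube n. f \<eta> = indicator A) \<longrightarrow>
       ereal (c * upper_Banach_density A ^ (2 ^ n)) \<le> family_density n f \<and>
       family_density n f \<le>
         ereal (C * upper_Banach_density A powr (real (n + 1) / 2 ^ n)))"
proof (intro exI conjI allI impI)
  fix A :: "(real^2) set" and f :: "(nat \<Rightarrow> nat) \<Rightarrow> real^2 \<Rightarrow> real"
  assume A: "A \<in> sets lebesgue"
    and f: "\<forall>\<eta>\<in>bin_cube n. f \<eta> \<in> {indicator A, indicator UNIV}"
    and "\<exists>\<eta>\<in>bin_cube n. f \<eta> = indicator A"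
  then obtain \<theta> where \<theta>: "\<theta> \<in> bin_cube n" "f \<theta> = indicator A" by blast
  let ?\<delta> = "upper_Banach_density A" and ?p = "real (n + 1) / 2 ^ n"
  \<comment> \<open>The two \<open>show\<close> statements fix the witnesses: \<open>c\<close> is
    \<open>1 / 16 ^ (2 ^ n - 1)\<close> and \<open>C\<close> is 1.\<close>
  show "ereal (1 / 16 ^ (2 ^ n - 1) * ?\<delta> ^ (2 ^ n)) \<le> family_density n f"
    by (rule family_density_lower[OF A f])
  have "n + 1 \<le> 2 ^ n"
    using less_exp[of n] by (simp only: Suc_eq_plus1[symmetric] Suc_le_eq)
  then have "real (n + 1) \<le> real (2 ^ n)"
    by (simp only: of_nat_le_iff)
  then have "?p \<le> 1"
    by simp
  \<comment> \<open>On [0,1] lowering the exponent from 1 to \<open>?p\<close> can only increase the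
    power.\<close>
  then have "?\<delta> \<le> ?\<delta> powr ?p"
    using powr_mono'[of ?p 1 ?\<delta>] upper_Banach_density_Limsup(2,3)[OF A] by simp
  then show "family_density n f \<le> ereal (1 * ?\<delta> powr ?p)"
    using family_density_upper[OF A f \<theta>] by (simp add: order_trans)
qed auto

end
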